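(* Let $n\ge1$, $p\in\{0,1,2,\dots\}\cup\{+\infty\}$, $f\in A^p(D^n)$ and $\zeta\in\mathbb{T}^n$. The function $f$ is holomorphically extendable at $\zeta$ (as a function on the domain $D^n$) if and only if $f|_{\mathbb{T}^n}$ is holomorphically extendable at $\zeta$ (as a function on $\mathbb{T}^n$).
   Context: $D$ is the open unit disc and $\mathbb{T}$ the unit circle in $\mathbb{C}$. $A^p(D^n)$ is the set of holomorphic functions $f:D^n\to\mathbb{C}$ such that $\frac{\partial^{\alpha}f}{\partial z^{\alpha}}$ extends continuously to $\overline{D^n}$ for every multi-index $\alpha\in\mathbb{N}^n$ with $|\alpha|\le p$ (all $\alpha$ if $p=+\infty$). $f|_{\mathbb{T}^n}$ denotes the restriction to $\mathbb{T}^n$ of the continuous extension of $f$ to $\overline{D^n}$. A holomorphic function $f$ on $D^n$ is holomorphically extendable at $\zeta\in\partial D^n$ if there are an open ball $B(\zeta,r)\subseteq\mathbb{C}^n$, $r>0$, and a holomorphic function $F:B(\zeta,r)\to\mathbb{C}$ such that $F=f$ on a connected component of $B(\zeta,r)\cap D^n$. A function $g:\mathbb{T}^n\to\mathbb{C}$ is holomorphically extendable at $\zeta\in\mathbb{T}^n$ if there are an open neighborhood $U\subseteq\mathbb{C}^n$ of $\zeta$ and a holomorphic function $F:U\to\mathbb{C}$ agreeing with $g$ on $U\cap\mathbb{T}^n$. *)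

theory Defs
  imports "HOL-Analysis.Analysis" "HOL-Library.Extended_Nat"
begin

text \<open>
  The space \<open>\<complex>\<^sup>n\<close> is \<^typ>\<open>complex ^ 'n\<close> with its Euclidean norm; \<open>n = CARD('n) \<ge> 1\<close>
  because types are nonempty.
\<close>

definition polydisc :: "(complex ^ 'n) set" where
  "polydisc = {z. \<forall>i. norm (z $ i) < 1}"

definition torus :: "(complex ^ 'n) set" where
  "torus = {z. \<forall>i. norm (z $ i) = 1}"

text \<open>
  Complex differentiability in several variables: the (real-linear) Frechet derivative exists at
  every point and commutes with complex scalars. It is only used for open \<open>U\<close>.
\<close>

definition holomorphic_several :: "(complex ^ 'n \<Rightarrow> complex) \<Rightarrow> (complex ^ 'n) set \<Rightarrow> bool" where
  "holomorphic_several f U \<longleftrightarrow>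
     (\<forall>z\<in>U. \<exists>f'. (f has_derivative f') (at z) \<and> (\<forall>c h. f' (c *s h) = c * f' h))"

definition partial_deriv :: "'n \<Rightarrow> (complex ^ 'n \<Rightarrow> complex) \<Rightarrow> complex ^ 'n \<Rightarrow> complex" where
  "partial_deriv j f z = deriv (\<lambda>w. f (\<chi> i. if i = j then w else z $ i)) (z $ j)"

text \<open>
  The index type carries no order, so the coordinates are enumerated in some fixed order.
  Partial derivatives of holomorphic functions commute, so for these the order is immaterial.
\<close>

definition coordinates :: "'n::finite list" where
  "coordinates = (SOME js. distinct js \<and> set js = UNIV)"

definition multi_deriv ::
    "('n::finite \<Rightarrow> nat) \<Rightarrow> (complex ^ 'n \<Rightarrow> complex) \<Rightarrow> complex ^ 'n \<Rightarrow> complex" where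
  "multi_deriv \<alpha> f = foldr (\<lambda>j. partial_deriv j ^^ \<alpha> j) coordinates f"

definition is_continuous_extension ::
    "(complex ^ 'n \<Rightarrow> complex) \<Rightarrow> (complex ^ 'n \<Rightarrow> complex) \<Rightarrow> bool" where
  "is_continuous_extension f g \<longleftrightarrow>
     continuous_on (closure polydisc) g \<and> (\<forall>z\<in>polydisc. g z = f z)"

text \<open>Functions are total in HOL; the values of \<open>f\<close> off the polydisc play no role.\<close>

definition A_space :: "enat \<Rightarrow> (complex ^ 'n::finite \<Rightarrow> complex) set" where
  "A_space p = {f. holomorphic_several f polydisc \<and>
     (\<forall>\<alpha>. enat (\<Sum>i\<in>UNIV. \<alpha> i) \<le> p \<longrightarrow> (\<exists>g. is_continuous_extension (multi_deriv \<alpha> f) g))}"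

text \<open>A continuous extension is determined on \<open>closure polydisc\<close>, hence on \<open>torus\<close>, by \<open>f\<close>.\<close>

definition torus_restriction :: "(complex ^ 'n \<Rightarrow> complex) \<Rightarrow> complex ^ 'n \<Rightarrow> complex" where
  "torus_restriction f = restrict (SOME g. is_continuous_extension f g) torus"

definition extendable_from_polydisc :: "(complex ^ 'n \<Rightarrow> complex) \<Rightarrow> complex ^ 'n \<Rightarrow> bool" where
  "extendable_from_polydisc f \<zeta> \<longleftrightarrow>
     (\<exists>r>0. \<exists>F. holomorphic_several F (ball \<zeta> r) \<and>
        (\<exists>C\<in>components (ball \<zeta> r \<inter> polydisc). \<forall>z\<in>C. F z = f z))"

definition extendable_from_torus :: "(complex ^ 'n \<Rightarrow> complex) \<Rightarrow> complex ^ 'n \<Rightarrow> bool" where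
  "extendable_from_torus g \<zeta> \<longleftrightarrow>
     (\<exists>U F. open U \<and> \<zeta> \<in> U \<and> holomorphic_several F U \<and> (\<forall>z\<in>U \<inter> torus. F z = g z))"

end

theory Submission
  imports Defs "HOL-Complex_Analysis.Conformal_Mappings"
begin

text \<open>
  Write \<open>g\<close> for the continuous extension of \<open>f\<close> to the closed polydisc. If \<open>F\<close> extends \<open>f\<close>
  holomorphically to a ball at \<open>\<zeta>\<close>, then, a ball meeting the polydisc in a convex set, \<open>F\<close> agrees
  with \<open>f\<close> on all of that intersection, and by density with \<open>g\<close> on the part of the torus inside
  the ball.

  The converse is a uniqueness statement: if \<open>F\<close> is holomorphic near \<open>\<zeta>\<close> and \<open>F = g\<close> on the torus
  near \<open>\<zeta>\<close>, then \<open>F = f\<close> in the polydisc near \<open>\<zeta>\<close>. It reduces to one variable, because every point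
  \<open>z\<close> of the polydisc close to \<open>\<zeta>\<close> lies on a short analytic disc attached to the torus. Indeed, put
  \<open>L\<^sub>i = Ln (z\<^sub>i / \<zeta>\<^sub>i)\<close>, a small number with negative real part, and
  \<open>\<Phi>\<^sub>i(t) = \<zeta>\<^sub>i exp (\<i> Im L\<^sub>i - \<i> t Re L\<^sub>i)\<close>. Since \<open>\<bar>\<Phi>\<^sub>i(t)\<bar> = exp (Re L\<^sub>i Im t)\<close>, the
  curve \<open>\<Phi>\<close> maps the real line into the torus and the upper half plane into the polydisc, and
  \<open>\<Phi>(\<i>) = z\<close>; for \<open>\<bar>t\<bar> < 2\<close> it stays near \<open>\<zeta>\<close>. So \<open>(F - g) \<circ> \<Phi>\<close> is continuous on a half disc,
  holomorphic above the real diameter and zero on it. Continued by zero into the lower half disc it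
  is holomorphic (Morera), hence identically zero, in particular at \<open>t = \<i>\<close>.
\<close>

section \<open>Boundary uniqueness in one variable\<close>

text \<open>
  The continuation of \<open>k\<close> by zero below the real line is continuous, hence holomorphic by
  Morera's theorem, and it vanishes on a nonempty open set.
\<close>

lemma eq_zero_if_zero_on_real_line:
  fixes k :: "complex \<Rightarrow> complex"
  assumes S: "open S" "connected S" and x: "x \<in> S" "Im x = 0"
    and cont: "continuous_on (S \<inter> {z. 0 \<le> Im z}) k"
    and hol: "k holomorphic_on (S \<inter> {z. 0 < Im z})"
    and zero: "\<And>z. z \<in> S \<Longrightarrow> Im z = 0 \<Longrightarrow> k z = 0"
    and w: "w \<in> S" "0 \<le> Im w"
  shows "k w = 0"
proof -
  define K where "K z = (if 0 \<le> Im z then k z else 0)" for z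
  have "continuous_on ((S \<inter> {z. 0 \<le> Im z}) \<union> (S \<inter> {z. Im z \<le> 0})) K"
    unfolding K_def
  proof (rule continuous_on_cases_local)
    show "closedin (top_of_set (S \<inter> {z. 0 \<le> Im z} \<union> S \<inter> {z. Im z \<le> 0})) (S \<inter> {z. 0 \<le> Im z})"
      using closed_halfspace_Im_ge[of 0] by (auto simp: closedin_closed)
    show "closedin (top_of_set (S \<inter> {z. 0 \<le> Im z} \<union> S \<inter> {z. Im z \<le> 0})) (S \<inter> {z. Im z \<le> 0})"
      using closed_halfspace_Im_le[of 0] by (auto simp: closedin_closed)
  qed (use cont zero in auto)
  moreover have "(S \<inter> {z. 0 \<le> Im z}) \<union> (S \<inter> {z. Im z \<le> 0}) = S"
    by auto
  ultimately have contK: "continuous_on S K"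
    by simp
  have "K holomorphic_on S \<inter> {z. \<i> \<bullet> z < 0}"
    by (rule holomorphic_transform[of "\<lambda>_. 0"]) (auto simp: K_def)
  moreover have "K holomorphic_on S \<inter> {z. 0 < \<i> \<bullet> z}"
    by (rule holomorphic_transform[of k]) (use hol in \<open>auto simp: K_def\<close>)
  ultimately have holK: "K holomorphic_on S"
    using holomorphic_on_paste_across_line[OF \<open>open S\<close>, of \<i> K 0] contK by simp
  have openL: "open (S \<inter> {z. Im z < 0})"
    using S open_halfspace_Im_lt[of 0] by auto
  obtain e where e: "0 < e" "ball x e \<subseteq> S"
    using S x open_contains_ball by blast
  have "x - \<i> * of_real (e / 2) \<in> ball x e"
    using e by (simp add: dist_norm norm_mult)
  with e x have "x - \<i> * of_real (e / 2) \<in> S \<inter> {z. Im z < 0}"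
    by auto
  then have "S \<inter> {z. Im z < 0} \<noteq> {}"
    by blast
  then have "K w = 0"
    by (rule analytic_continuation_open[OF openL \<open>open S\<close> _ \<open>connected S\<close>, where f = K and g = "\<lambda>_. 0"])
       (use holK w in \<open>auto simp: K_def\<close>)
  with w show ?thesis
    by (simp add: K_def)
qed

section \<open>Analytic discs and the polydisc\<close>

text \<open>
  Complex linearity of the derivative of \<open>F\<close> is what turns the chain rule into a complex
  derivative: the derivative of the curve in direction \<open>h\<close> is \<open>h\<close> times a fixed vector.
\<close>

lemma holomorphic_several_compose_curve:
  fixes F :: "complex ^ 'n::finite \<Rightarrow> complex" and \<phi> :: "'n \<Rightarrow> complex \<Rightarrow> complex"
  assumes F: "holomorphic_several F U" and S: "open S"
    and \<phi>: "\<And>i. \<phi> i holomorphic_on S"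
    and maps: "\<And>t. t \<in> S \<Longrightarrow> (\<chi> i. \<phi> i t) \<in> U"
  shows "(\<lambda>t. F (\<chi> i. \<phi> i t)) holomorphic_on S"
  unfolding holomorphic_on_open[OF S]
proof
  fix t assume t: "t \<in> S"
  define v where "v = (\<chi> i. deriv (\<phi> i) t)"
  have d: "(\<phi> i has_derivative (\<lambda>h. deriv (\<phi> i) t * h)) (at t)" for i
    using holomorphic_derivI[OF \<phi> S t] by (simp add: has_field_derivative_def)
  have curve: "((\<lambda>t. \<chi> i. \<phi> i t) has_derivative (\<lambda>h. h *s v)) (at t)"
    unfolding has_derivative_componentwise_within[of "\<lambda>t. \<chi> i. \<phi> i t"]
  proof
    fix b :: "complex ^ 'n" assume "b \<in> Basis"
    then obtain i c where b: "b = axis i c"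
      by (auto simp: Basis_vec_def)
    show "((\<lambda>t. (\<chi> i. \<phi> i t) \<bullet> b) has_derivative (\<lambda>h. (h *s v) \<bullet> b)) (at t)"
      using has_derivative_inner_left[OF d[of i], of c]
      by (simp add: b inner_axis v_def mult.commute)
  qed
  obtain F' where F': "(F has_derivative F') (at (\<chi> i. \<phi> i t))" "\<And>c h. F' (c *s h) = c * F' h"
    using F maps[OF t] unfolding holomorphic_several_def by blast
  have "((\<lambda>t. F (\<chi> i. \<phi> i t)) has_derivative (\<lambda>h. F' (h *s v))) (at t)"
    using diff_chain_at[OF curve F'(1)] by (simp add: o_def)
  moreover have "(\<lambda>h. F' (h *s v)) = (*) (F' v)"
    by (simp add: F'(2) mult.commute fun_eq_iff)
  ultimately show "\<exists>D. ((\<lambda>t. F (\<chi> i. \<phi> i t)) has_field_derivative D) (at t)"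
    by (auto simp: has_field_derivative_def)
qed

lemma holomorphic_several_continuous_on:
  assumes "holomorphic_several F U"
  shows "continuous_on U F"
  using assms unfolding holomorphic_several_def
  by (meson continuous_at_imp_continuous_on has_derivative_continuous)

lemma convex_polydisc: "convex (polydisc :: (complex ^ 'n::finite) set)"
proof -
  have "polydisc = (\<Inter>i. (\<lambda>z::complex ^ 'n. z $ i) -` ball 0 1)"
    by (auto simp: polydisc_def)
  moreover have "linear (\<lambda>z::complex ^ 'n. z $ i)" for i
    by (simp add: bounded_linear.linear bounded_linear_vec_nth)
  ultimately show ?thesis
    by (metis convex_INT convex_ball convex_linear_vimage)
qed

lemma closed_unit_polydisc_subset_closure:
  fixes z :: "complex ^ 'n::finite"
  assumes "\<And>i. norm (z $ i) \<le> 1"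
  shows "z \<in> closure polydisc"
  unfolding closure_sequential
proof (intro exI conjI allI)
  fix m :: nat
  have "norm (((1 - inverse (real (Suc m))) *\<^sub>R z) $ i) < 1" for i
  proof -
    have c: "0 \<le> 1 - inverse (real (Suc m))" "1 - inverse (real (Suc m)) < 1"
      by (simp_all add: field_simps)
    have "norm (((1 - inverse (real (Suc m))) *\<^sub>R z) $ i)
        = (1 - inverse (real (Suc m))) * norm (z $ i)"
      using c by simp
    also have "\<dots> \<le> 1 - inverse (real (Suc m))"
      using c assms[of i] mult_left_le by blast
    finally show ?thesis
      using c by linarith
  qed
  then show "(1 - inverse (real (Suc m))) *\<^sub>R z \<in> polydisc"
    by (simp add: polydisc_def)
next
  have "(\<lambda>m. (1 - inverse (real (Suc m))) *\<^sub>R z) \<longlonglongrightarrow> (1 - 0) *\<^sub>R z"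
    by (intro tendsto_intros LIMSEQ_inverse_real_of_nat)
  then show "(\<lambda>m. (1 - inverse (real (Suc m))) *\<^sub>R z) \<longlonglongrightarrow> z"
    by simp
qed

lemma torus_subset_closure_polydisc: "torus \<subseteq> closure (polydisc :: (complex ^ 'n::finite) set)"
  by (auto simp: torus_def intro!: closed_unit_polydisc_subset_closure)

text \<open>
  The scale \<open>2\<close> leaves room for \<open>t = \<i>\<close> in the domain of the disc. Smallness of \<open>z / \<zeta> - 1\<close> bounds
  \<open>L = Ln (z / \<zeta>)\<close>, and then \<open>\<i> Im L - \<i> t Re L\<close>, the logarithm of the curve relative to \<open>\<zeta>\<close>, is at
  most \<open>3 \<bar>L\<bar>\<close>.
\<close>

lemma exists_disc_attached_to_torus:
  fixes \<zeta> :: "complex ^ 'n::finite"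
  assumes U: "open U" "\<zeta> \<in> U" and \<zeta>: "\<zeta> \<in> torus"
  obtains r where "0 < r"
    and "\<And>z. z \<in> ball \<zeta> r \<Longrightarrow> z \<in> polydisc \<Longrightarrow>
      \<exists>\<phi>. (\<forall>i. \<phi> i holomorphic_on UNIV) \<and> (\<chi> i. \<phi> i \<i>) = z \<and>
        (\<forall>t\<in>ball 0 2. (\<chi> i. \<phi> i t) \<in> U) \<and>
        (\<forall>t. 0 < Im t \<longrightarrow> (\<chi> i. \<phi> i t) \<in> polydisc) \<and>
        (\<forall>t. Im t = 0 \<longrightarrow> (\<chi> i. \<phi> i t) \<in> torus)"
proof -
  have norm\<zeta>: "norm (\<zeta> $ i) = 1" for i
    using \<zeta> by (simp add: torus_def)
  then have \<zeta>0: "\<zeta> $ i \<noteq> 0" for i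
    by (metis norm_zero zero_neq_one)
  define E where "E w = (\<chi> i. \<zeta> $ i * exp (w $ i))" for w :: "complex ^ 'n"
  define Q where "Q z = (\<chi> i. Ln (z $ i / \<zeta> $ i))" for z :: "complex ^ 'n"
  have "continuous_on UNIV E"
    unfolding E_def by (intro continuous_intros)
  then have "open (E -` U)"
    using U(1) by (rule open_vimage[rotated])
  moreover have "0 \<in> E -` U"
    using U(2) by (simp add: E_def)
  ultimately obtain \<delta> where \<delta>: "0 < \<delta>" "ball 0 \<delta> \<subseteq> E -` U"
    unfolding open_contains_ball by blast
  have "(Q \<longlongrightarrow> (\<chi> i. Ln (\<zeta> $ i / \<zeta> $ i))) (at \<zeta>)"
    unfolding Q_def using \<zeta>0 by (intro tendsto_vec_lambda tendsto_intros) auto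
  then have "isCont Q \<zeta>"
    by (simp add: isCont_def Q_def)
  moreover have "Q \<zeta> = 0"
    using \<zeta>0 by (simp add: Q_def vec_eq_iff)
  ultimately obtain r\<^sub>1 where r1: "0 < r\<^sub>1" "\<And>z. dist z \<zeta> < r\<^sub>1 \<Longrightarrow> norm (Q z) < \<delta> / 3"
    using \<delta>(1) unfolding continuous_at_eps_delta
    by (auto dest: spec[of _ "\<delta> / 3"])
  show thesis
  proof
    \<comment> \<open>a radius at most \<open>1\<close> keeps the coordinates of \<open>z\<close> away from \<open>0\<close>, the singularity of \<open>Ln\<close>\<close>
    show "0 < min 1 r\<^sub>1"
      using r1 by simp
    fix z assume z: "z \<in> ball \<zeta> (min 1 r\<^sub>1)" "z \<in> polydisc"
    have z0: "z $ i \<noteq> 0" for i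
    proof
      assume "z $ i = 0"
      then have "norm ((\<zeta> - z) $ i) = 1"
        by (simp add: norm\<zeta>)
      moreover have "norm ((\<zeta> - z) $ i) \<le> norm (\<zeta> - z)"
        by (rule Finite_Cartesian_Product.norm_nth_le)
      ultimately show False
        using z by (simp add: dist_norm)
    qed
    define L where "L i = Q z $ i" for i
    define \<phi> where "\<phi> i t = \<zeta> $ i * exp (\<i> * of_real (Im (L i)) - \<i> * t * of_real (Re (L i)))" for i t
    have ReL: "Re (L i) < 0" for i
      using z z0[of i] \<zeta>0[of i] by (simp add: L_def Q_def norm_divide norm\<zeta> polydisc_def)
    have norm\<phi>: "norm (\<phi> i t) = exp (Im t * Re (L i))" for i t
      by (simp add: \<phi>_def norm_mult norm\<zeta>)
    have "\<phi> i holomorphic_on UNIV" for i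
      unfolding \<phi>_def by (intro holomorphic_intros)
    moreover have "(\<chi> i. \<phi> i \<i>) = z"
    proof -
      have "\<phi> i \<i> = z $ i" for i
      proof -
        have "\<i> * of_real (Im (L i)) - \<i> * \<i> * of_real (Re (L i)) = L i"
          by (simp add: complex_eq_iff)
        then have "\<phi> i \<i> = \<zeta> $ i * exp (L i)"
          by (simp add: \<phi>_def)
        also have "\<dots> = z $ i"
          using z0[of i] \<zeta>0[of i] by (simp add: L_def Q_def)
        finally show ?thesis .
      qed
      then show ?thesis
        by (simp add: vec_eq_iff)
    qed
    moreover have "(\<chi> i. \<phi> i t) \<in> U" if "t \<in> ball 0 2" for t
    proof -
      define w where "w = (\<chi> i. \<i> * of_real (Im (L i)) - \<i> * t * of_real (Re (L i)))"
      have "norm (w $ i) \<le> norm ((3 *\<^sub>R Q z) $ i)" for i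
      proof -
        have "norm (w $ i) \<le> \<bar>Im (L i)\<bar> + norm t * \<bar>Re (L i)\<bar>"
          unfolding w_def using norm_triangle_ineq4[of "\<i> * of_real (Im (L i))" "\<i> * t * of_real (Re (L i))"]
          by (simp add: norm_mult)
        also have "\<dots> \<le> norm (L i) + 2 * norm (L i)"
          using that abs_Im_le_cmod[of "L i"] abs_Re_le_cmod[of "L i"]
          by (intro add_mono mult_mono) auto
        finally show ?thesis
          by (simp add: L_def)
      qed
      then have "norm w \<le> norm (3 *\<^sub>R Q z)"
        by (rule norm_le_componentwise_cart)
      also have "\<dots> < \<delta>"
        using r1(2)[of z] z by (simp add: dist_commute)
      finally have "E w \<in> U"
        using \<delta>(2) by auto
      then show ?thesis
        by (simp add: E_def w_def \<phi>_def)
    qed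
    moreover have "(\<chi> i. \<phi> i t) \<in> polydisc" if "0 < Im t" for t
      using that ReL by (simp add: polydisc_def norm\<phi> mult_pos_neg)
    moreover have "(\<chi> i. \<phi> i t) \<in> torus" if "Im t = 0" for t
      using that by (simp add: torus_def norm\<phi>)
    ultimately show "\<exists>\<phi>. (\<forall>i. \<phi> i holomorphic_on UNIV) \<and> (\<chi> i. \<phi> i \<i>) = z \<and>
        (\<forall>t\<in>ball 0 2. (\<chi> i. \<phi> i t) \<in> U) \<and>
        (\<forall>t. 0 < Im t \<longrightarrow> (\<chi> i. \<phi> i t) \<in> polydisc) \<and>
        (\<forall>t. Im t = 0 \<longrightarrow> (\<chi> i. \<phi> i t) \<in> torus)"
      by (intro exI[of _ \<phi>]) blast
  qed
qed

section \<open>Extensions of functions continuous up to the boundary\<close>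

text \<open>The multi-index \<open>0\<close> is admissible for every \<open>p\<close>, and differentiating along it changes nothing.\<close>

lemma A_space_continuous_extension:
  assumes "f \<in> A_space p"
  shows "holomorphic_several f polydisc" and "\<exists>g. is_continuous_extension f g"
proof -
  show "holomorphic_several f polydisc"
    using assms by (simp add: A_space_def)
  have "foldr (\<lambda>j. partial_deriv j ^^ 0) js f = f" for js
    by (induction js) auto
  then have "multi_deriv (\<lambda>_. 0) f = f"
    by (simp add: multi_deriv_def)
  moreover have "\<exists>g. is_continuous_extension (multi_deriv (\<lambda>_. 0) f) g"
    using assms unfolding A_space_def by (auto simp flip: zero_enat_def)
  ultimately show "\<exists>g. is_continuous_extension f g"
    by simp
qed

lemma eq_on_closure_polydisc:
  fixes F g :: "complex ^ 'n::finite \<Rightarrow> complex"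
  assumes U: "open U" and F: "continuous_on U F" and g: "continuous_on (closure polydisc) g"
    and eq: "\<And>z. z \<in> U \<inter> polydisc \<Longrightarrow> F z = g z"
    and z: "z \<in> U" "z \<in> closure polydisc"
  shows "F z = g z"
proof -
  have "z \<in> closure (U \<inter> polydisc)"
    using open_Int_closure_subset[OF U] z by blast
  then obtain s where s: "\<And>m. s m \<in> U \<inter> polydisc" "s \<longlonglongrightarrow> z"
    unfolding closure_sequential by blast
  have "(\<lambda>m. F (s m)) \<longlonglongrightarrow> F z"
    using continuous_on_tendsto_compose[OF F s(2) z(1)] s(1) by simp
  moreover have "(\<lambda>m. g (s m)) \<longlonglongrightarrow> g z"
    by (rule continuous_on_tendsto_compose[OF g s(2) z(2)])
       (use s(1) closure_subset in \<open>blast intro: always_eventually\<close>)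
  moreover have "(\<lambda>m. F (s m)) = (\<lambda>m. g (s m))"
    using eq[OF s(1)] by simp
  ultimately show ?thesis
    by (metis LIMSEQ_unique)
qed

text \<open>
  Boundary uniqueness in several variables: restricted to an attached disc, \<open>F - g\<close> satisfies the
  one-variable uniqueness principle, and such discs fill the polydisc near \<open>\<zeta>\<close>.
\<close>

lemma eq_near_torus_point:
  fixes f F g :: "complex ^ 'n::finite \<Rightarrow> complex"
  assumes f: "holomorphic_several f polydisc" and g: "is_continuous_extension f g"
    and U: "open U" "\<zeta> \<in> U" and \<zeta>: "\<zeta> \<in> torus"
    and F: "holomorphic_several F U" and eq: "\<And>z. z \<in> U \<inter> torus \<Longrightarrow> F z = g z"
  obtains r where "0 < r" "ball \<zeta> r \<subseteq> U" "\<And>z. z \<in> ball \<zeta> r \<inter> polydisc \<Longrightarrow> F z = f z"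
proof -
  obtain r\<^sub>0 where r0: "0 < r\<^sub>0" "ball \<zeta> r\<^sub>0 \<subseteq> U"
    using U open_contains_ball by blast
  obtain r where r: "0 < r"
    and disc: "\<And>z. z \<in> ball \<zeta> r \<Longrightarrow> z \<in> polydisc \<Longrightarrow>
      \<exists>\<phi>. (\<forall>i. \<phi> i holomorphic_on UNIV) \<and> (\<chi> i. \<phi> i \<i>) = z \<and>
        (\<forall>t\<in>ball 0 2. (\<chi> i. \<phi> i t) \<in> U) \<and>
        (\<forall>t. 0 < Im t \<longrightarrow> (\<chi> i. \<phi> i t) \<in> polydisc) \<and>
        (\<forall>t. Im t = 0 \<longrightarrow> (\<chi> i. \<phi> i t) \<in> torus)"
    using exists_disc_attached_to_torus[OF U \<zeta>] by blast
  have gcont: "continuous_on (closure polydisc) g" and gf: "\<And>z. z \<in> polydisc \<Longrightarrow> g z = f z"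
    using g by (auto simp: is_continuous_extension_def)
  have "F z = f z" if z: "z \<in> ball \<zeta> r" "z \<in> polydisc" for z
  proof -
    obtain \<phi> where \<phi>: "\<And>i. \<phi> i holomorphic_on UNIV" and z_eq: "(\<chi> i. \<phi> i \<i>) = z"
      and inU: "\<And>t. t \<in> ball 0 2 \<Longrightarrow> (\<chi> i. \<phi> i t) \<in> U"
      and inP: "\<And>t. 0 < Im t \<Longrightarrow> (\<chi> i. \<phi> i t) \<in> polydisc"
      and inT: "\<And>t. Im t = 0 \<Longrightarrow> (\<chi> i. \<phi> i t) \<in> torus"
      using disc[OF z] by blast
    define \<Phi> where "\<Phi> t = (\<chi> i. \<phi> i t)" for t
    have cont\<Phi>: "continuous_on A \<Phi>" for A
      unfolding \<Phi>_def
      by (intro continuous_on_vec_lambda holomorphic_on_imp_continuous_on holomorphic_on_subset[OF \<phi>]) simp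
    have inC: "\<Phi> t \<in> closure polydisc" if "0 \<le> Im t" for t
      using that inP[of t] inT[of t] torus_subset_closure_polydisc closure_subset[of polydisc]
      unfolding \<Phi>_def by (cases "Im t = 0") auto
    have "F (\<Phi> \<i>) - g (\<Phi> \<i>) = 0"
    proof (rule eq_zero_if_zero_on_real_line[where S = "ball 0 2" and x = 0
          and k = "\<lambda>t. F (\<Phi> t) - g (\<Phi> t)"])
      have "continuous_on (ball 0 2) (\<lambda>t. F (\<Phi> t))"
        by (rule continuous_on_compose2[OF holomorphic_several_continuous_on[OF F] cont\<Phi>])
           (use inU \<Phi>_def in auto)
      moreover have "continuous_on {t. 0 \<le> Im t} (\<lambda>t. g (\<Phi> t))"
        by (rule continuous_on_compose2[OF gcont cont\<Phi>]) (use inC in auto)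
      ultimately show "continuous_on (ball 0 2 \<inter> {t. 0 \<le> Im t}) (\<lambda>t. F (\<Phi> t) - g (\<Phi> t))"
        by (auto intro!: continuous_on_diff elim: continuous_on_subset)
      have op: "open (ball (0::complex) 2 \<inter> {t. 0 < Im t})"
        using open_halfspace_Im_gt[of 0] by auto
      have "(\<lambda>t. F (\<Phi> t)) holomorphic_on ball 0 2 \<inter> {t. 0 < Im t}"
        unfolding \<Phi>_def
        by (rule holomorphic_several_compose_curve[OF F op])
           (use inU in \<open>auto intro: holomorphic_on_subset[OF \<phi>]\<close>)
      moreover have "(\<lambda>t. f (\<Phi> t)) holomorphic_on ball 0 2 \<inter> {t. 0 < Im t}"
        unfolding \<Phi>_def
        by (rule holomorphic_several_compose_curve[OF f op])
           (use inP in \<open>auto intro: holomorphic_on_subset[OF \<phi>]\<close>)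
      ultimately have "(\<lambda>t. F (\<Phi> t) - f (\<Phi> t)) holomorphic_on ball 0 2 \<inter> {t. 0 < Im t}"
        by (rule holomorphic_on_diff)
      then show "(\<lambda>t. F (\<Phi> t) - g (\<Phi> t)) holomorphic_on ball 0 2 \<inter> {t. 0 < Im t}"
        by (rule holomorphic_transform) (use gf inP \<Phi>_def in auto)
      show "F (\<Phi> t) - g (\<Phi> t) = 0" if "t \<in> ball 0 2" "Im t = 0" for t
        using eq inU inT that \<Phi>_def by auto
    qed auto
    then show ?thesis
      using gf z by (simp add: \<Phi>_def z_eq)
  qed
  then show thesis
    using that[of "min r r\<^sub>0"] r r0 by (simp add: subset_iff)
qed

theorem proposition9:
  fixes f :: "complex ^ 'n::finite \<Rightarrow> complex" and p :: enat and \<zeta> :: "complex ^ 'n"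
  assumes "f \<in> A_space p" and "\<zeta> \<in> torus"
  shows "extendable_from_polydisc f \<zeta> \<longleftrightarrow> extendable_from_torus (torus_restriction f) \<zeta>"
proof -
  define g where "g = (SOME g. is_continuous_extension f g)"
  have f: "holomorphic_several f polydisc"
    by (rule A_space_continuous_extension[OF assms(1)])
  have g: "is_continuous_extension f g"
    unfolding g_def using A_space_continuous_extension(2)[OF assms(1)] by (rule someI_ex)
  have restr: "torus_restriction f z = g z" if "z \<in> torus" for z
    using that by (simp add: torus_restriction_def g_def)
  have comp: "components (ball \<zeta> r \<inter> polydisc) = {ball \<zeta> r \<inter> polydisc}" if r: "0 < r" for r
  proof -
    have "\<zeta> \<in> closure polydisc"
      using assms(2) torus_subset_closure_polydisc by blast
    then obtain y where "y \<in> polydisc" "dist y \<zeta> < r"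
      using r unfolding closure_approachable by blast
    then have "ball \<zeta> r \<inter> polydisc \<noteq> {}"
      by (auto simp: dist_commute)
    then show ?thesis
      unfolding components_eq_sing_iff
      by (simp add: convex_connected convex_Int convex_polydisc)
  qed
  show ?thesis
  proof
    assume "extendable_from_polydisc f \<zeta>"
    then obtain r F where r: "0 < r" and F: "holomorphic_several F (ball \<zeta> r)"
      and Ff: "\<And>z. z \<in> ball \<zeta> r \<inter> polydisc \<Longrightarrow> F z = f z"
      unfolding extendable_from_polydisc_def using comp by (metis singletonD)
    have "F z = g z" if "z \<in> ball \<zeta> r" "z \<in> torus" for z
    proof (rule eq_on_closure_polydisc[OF open_ball holomorphic_several_continuous_on[OF F]])
      show "continuous_on (closure polydisc) g"
        using g by (simp add: is_continuous_extension_def)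
      show "F z = g z" if "z \<in> ball \<zeta> r \<inter> polydisc" for z
        using g Ff that by (simp add: is_continuous_extension_def)
      show "z \<in> ball \<zeta> r" "z \<in> closure polydisc"
        using that torus_subset_closure_polydisc by auto
    qed
    then show "extendable_from_torus (torus_restriction f) \<zeta>"
      unfolding extendable_from_torus_def using r F restr
      by (intro exI[of _ "ball \<zeta> r"] exI[of _ F]) auto
  next
    assume "extendable_from_torus (torus_restriction f) \<zeta>"
    then obtain U F where U: "open U" "\<zeta> \<in> U" and F: "holomorphic_several F U"
      and eq: "\<And>z. z \<in> U \<inter> torus \<Longrightarrow> F z = g z"
      unfolding extendable_from_torus_def using restr by auto
    obtain r where r: "0 < r" "ball \<zeta> r \<subseteq> U" "\<And>z. z \<in> ball \<zeta> r \<inter> polydisc \<Longrightarrow> F z = f z"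
      using eq_near_torus_point[OF f g U assms(2) F eq] by blast
    moreover have "holomorphic_several F (ball \<zeta> r)"
      using F r(2) by (auto simp: holomorphic_several_def)
    ultimately show "extendable_from_polydisc f \<zeta>"
      unfolding extendable_from_polydisc_def using comp[OF r(1)]
      by (intro exI[of _ r] conjI exI[of _ F]) auto
  qed
qed

end
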